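(* If $G$ is a connected graph, then $rc(G)\leq 2\alpha(G)-1$, where $\alpha(G)$ is the independence number of $G$. Moreover, the bound is best possible: there exist connected graphs $G$ with $rc(G)=2\alpha(G)-1$.
   Context: All graphs are simple, finite and undirected. For an edge-coloring of a connected graph $G$, a path is rainbow if no two of its edges receive the same color; the coloring makes $G$ rainbow connected if every two vertices of $G$ are joined by a rainbow path. The rainbow connection number $rc(G)$ is the minimum number of colors in an edge-coloring making $G$ rainbow connected. The independence number $\alpha(G)$ is the maximum size of a set of pairwise non-adjacent vertices of $G$. *)

theory Defs
  imports "Graph_Theory.Digraph_Component"
begin

text \<open>
  Finite simple undirected graphs are the library's locale predicate \<open>graph\<close>: finite, loop-free,
  symmetric digraphs without parallel arcs. An undirected edge is thus a pair of opposite arcs.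
  It is identified below with the set of its two ends, so that an edge-coloring cannot
  distinguish the two orientations.
\<close>

definition edge_of :: "('a, 'b) pre_digraph \<Rightarrow> 'b \<Rightarrow> 'a set" where
  "edge_of G e = {tail G e, head G e}"

definition uedges :: "('a, 'b) pre_digraph \<Rightarrow> 'a set set" where
  "uedges G = edge_of G ` arcs G"

definition rainbow :: "('a, 'b) pre_digraph \<Rightarrow> ('a set \<Rightarrow> nat) \<Rightarrow> 'b awalk \<Rightarrow> bool" where
  "rainbow G c p \<longleftrightarrow> distinct (map (\<lambda>e. c (edge_of G e)) p)"

definition rainbow_connected :: "('a, 'b) pre_digraph \<Rightarrow> ('a set \<Rightarrow> nat) \<Rightarrow> bool" where
  "rainbow_connected G c \<longleftrightarrow>
     (\<forall>u \<in> verts G. \<forall>v \<in> verts G. \<exists>p. pre_digraph.apath G u p v \<and> rainbow G c p)"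

text \<open>
  Only the colors that occur on edges of the graph are counted. For a connected finite graph the
  minimum exists, since coloring all edges differently makes the graph rainbow connected.
\<close>

definition rainbow_connection_number :: "('a, 'b) pre_digraph \<Rightarrow> nat" where
  "rainbow_connection_number G =
     (LEAST k. \<exists>c. rainbow_connected G c \<and> card (c ` uedges G) = k)"

definition independent_set :: "('a, 'b) pre_digraph \<Rightarrow> 'a set \<Rightarrow> bool" where
  "independent_set G S \<longleftrightarrow> S \<subseteq> verts G \<and> pairwise (\<lambda>u v. \<not> u \<rightarrow>\<^bsub>G\<^esub> v) S"

definition independence_number :: "('a, 'b) pre_digraph \<Rightarrow> nat" where
  "independence_number G = Max (card ` {S. independent_set G S})"

end

theory Submission
  imports Defs "HOL-Combinatorics.Transposition"
begin

text \<open>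
  Induction on the number of vertices. In a non-complete connected graph, take an inclusion-maximal
  connected vertex set \<open>H\<close> whose closed neighbourhood is not everything, let \<open>W\<close> be the set of
  vertices outside this closed neighbourhood and \<open>U\<close> the rest. Maximality forces \<open>U\<close> to be completely
  joined to \<open>W\<close>, and \<open>\<alpha>(H) + \<alpha>(W) \<le> \<alpha>(G)\<close>. Colour \<open>H\<close> with \<open>2\<alpha>(H) - 1\<close> colours by induction,
  use one new colour \<open>b\<close> between \<open>H\<close> and \<open>U\<close>, and \<open>\<alpha>(W)\<close> further ones on the edges from one vertex
  \<open>u\<^sub>0 \<in> U\<close> to \<open>W\<close>, so that \<open>w - u\<^sub>0 - H\<close> continues to a rainbow path.

  Inside \<open>W\<close> it suffices to use the star at \<open>u\<^sub>0\<close>: give the members of a maximum independent set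
  \<open>M\<close> of \<open>W\<close> distinct colours, give all other vertices the colour of a fixed \<open>m \<in> M\<close>, and colour the
  edges within \<open>W\<close> with one more colour. Two non-adjacent vertices of equal colour have a neighbour
  of one of them in \<open>M - {m}\<close>, otherwise \<open>M - {m}\<close> together with the two would be a larger
  independent set, and this neighbour gives a rainbow path of length three through \<open>u\<^sub>0\<close>. The same
  construction with a star at a vertex of \<open>W\<close> serves \<open>U\<close>; there all \<open>2\<alpha>(G) - 1\<close> colours may be reused.
\<close>

section \<open>Independence number and connectedness of vertex sets\<close>

text \<open>Relative to a relation and a vertex set, so that the induction can pass to
  \<open>H\<close> without forming induced subgraphs.\<close>

definition indep :: "('a \<Rightarrow> 'a \<Rightarrow> bool) \<Rightarrow> 'a set \<Rightarrow> 'a set \<Rightarrow> bool" where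
  "indep E S I \<longleftrightarrow> I \<subseteq> S \<and> pairwise (\<lambda>u v. \<not> E u v) I"

definition alpha :: "('a \<Rightarrow> 'a \<Rightarrow> bool) \<Rightarrow> 'a set \<Rightarrow> nat" where
  "alpha E S = Max (card ` {I. indep E S I})"

text \<open>Connectedness of the induced subgraph by cuts rather than paths, so that adding a
  neighbour to a set and finding an edge that leaves \<open>H\<close> need no walks.\<close>

definition cut_connected :: "('a \<Rightarrow> 'a \<Rightarrow> bool) \<Rightarrow> 'a set \<Rightarrow> bool" where
  "cut_connected E S \<longleftrightarrow> (\<forall>A \<subseteq> S. A \<noteq> {} \<longrightarrow> A \<noteq> S \<longrightarrow> (\<exists>x\<in>A. \<exists>y\<in>S - A. E x y))"

lemma finite_indeps: "finite S \<Longrightarrow> finite {I. indep E S I}"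
  by (rule finite_subset[of _ "Pow S"]) (auto simp: indep_def)

lemma card_le_alpha: "finite S \<Longrightarrow> indep E S I \<Longrightarrow> card I \<le> alpha E S"
  unfolding alpha_def by (rule Max_ge) (auto simp: finite_indeps)

lemma obtain_max_indep:
  assumes "finite S"
  obtains I where "indep E S I" "card I = alpha E S"
proof -
  have "indep E S {}" by (simp add: indep_def)
  then have "alpha E S \<in> card ` {I. indep E S I}"
    unfolding alpha_def by (intro Max_in) (auto simp: finite_indeps assms)
  then show ?thesis using that by auto
qed

lemma alpha_pos: "finite S \<Longrightarrow> S \<noteq> {} \<Longrightarrow> 0 < alpha E S"
proof -
  assume *: "finite S" "S \<noteq> {}"
  then obtain x where "x \<in> S" by auto
  then have "indep E S {x}" by (simp add: indep_def)
  from card_le_alpha[OF *(1) this] show ?thesis by simp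
qed

lemma alpha_mono:
  assumes "finite T" "S \<subseteq> T" shows "alpha E S \<le> alpha E T"
proof -
  obtain I where I: "indep E S I" "card I = alpha E S"
    using obtain_max_indep assms finite_subset by metis
  then have "indep E T I" using assms by (auto simp: indep_def)
  from card_le_alpha[OF assms(1) this] I show ?thesis by simp
qed

lemma alpha_add:
  assumes "finite V" "A \<subseteq> V" "B \<subseteq> V" "A \<inter> B = {}"
    and "\<And>x y. x \<in> A \<Longrightarrow> y \<in> B \<Longrightarrow> \<not> E x y \<and> \<not> E y x"
  shows "alpha E A + alpha E B \<le> alpha E V"
proof -
  have fin: "finite A" "finite B" using assms(1-3) by (auto intro: finite_subset)
  obtain I where I: "indep E A I" "card I = alpha E A" using obtain_max_indep fin by metis
  obtain J where J: "indep E B J" "card J = alpha E B" using obtain_max_indep fin by metis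
  have "indep E V (I \<union> J)"
    using I(1) J(1) assms(2,3,5) unfolding indep_def pairwise_def by blast
  moreover have "card (I \<union> J) = card I + card J"
  proof (rule card_Un_disjoint)
    show "finite I" "finite J" using I(1) J(1) fin by (auto simp: indep_def intro: finite_subset)
    show "I \<inter> J = {}" using I(1) J(1) assms(4) by (auto simp: indep_def)
  qed
  ultimately show ?thesis using card_le_alpha[OF assms(1)] I J by metis
qed

lemma cut_connected_singleton: "cut_connected E {h}"
  by (auto simp: cut_connected_def)

text \<open>If \<open>u\<close> is new, a cut either restricts to a cut of \<open>H\<close> or
  separates \<open>u\<close> from \<open>H\<close>; in the second case the edge between
  \<open>h\<close> and \<open>u\<close> crosses it, in one orientation or the other.\<close>

lemma cut_connected_insert:
  assumes H: "cut_connected E H" and h: "h \<in> H" "E h u" "E u h"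
  shows "cut_connected E (insert u H)"
  unfolding cut_connected_def
proof (intro allI impI)
  fix A assume A: "A \<subseteq> insert u H" "A \<noteq> {}" "A \<noteq> insert u H"
  show "\<exists>x\<in>A. \<exists>y\<in>insert u H - A. E x y"
  proof (cases "u \<in> H")
    case True
    then show ?thesis using H A unfolding cut_connected_def by (simp add: insert_absorb)
  next
    case False
    consider "A \<inter> H = {}" | "H \<subseteq> A" | "A \<inter> H \<noteq> {}" "A \<inter> H \<noteq> H" by blast
    then show ?thesis
    proof cases
      case 1
      then have "A = {u}" using A by auto
      then show ?thesis using h False by auto
    next
      case 2
      then have "A = H" using A by auto
      then show ?thesis using h False by auto
    next
      case 3
      then obtain x y where "x \<in> A \<inter> H" "y \<in> H - A \<inter> H" "E x y"
        using H unfolding cut_connected_def by (meson Int_lower2)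
      then show ?thesis by auto
    qed
  qed
qed

section \<open>Rainbow walks\<close>

text \<open>The last argument is the set of colours used.\<close>

inductive rainbow_walk ::
  "('a \<Rightarrow> 'a \<Rightarrow> bool) \<Rightarrow> ('a set \<Rightarrow> nat) \<Rightarrow> 'a set \<Rightarrow> 'a \<Rightarrow> 'a \<Rightarrow> nat set \<Rightarrow> bool"
  for E c S where
  refl: "u \<in> S \<Longrightarrow> rainbow_walk E c S u u {}"
| step: "u \<in> S \<Longrightarrow> E u w \<Longrightarrow> rainbow_walk E c S w v K \<Longrightarrow> c {u, w} \<notin> K \<Longrightarrow>
    rainbow_walk E c S u v (insert (c {u, w}) K)"

lemma rainbow_walk_ends: "rainbow_walk E c S u v K \<Longrightarrow> u \<in> S \<and> v \<in> S"
  by (induction rule: rainbow_walk.induct) auto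

lemma rainbow_walk_snoc:
  "rainbow_walk E c S u v K \<Longrightarrow> w \<in> S \<Longrightarrow> E v w \<Longrightarrow> c {v, w} \<notin> K \<Longrightarrow>
    rainbow_walk E c S u w (insert (c {v, w}) K)"
proof (induction rule: rainbow_walk.induct)
  case (refl u)
  then show ?case by (auto intro!: rainbow_walk.intros)
next
  case (step u x v K)
  then have "rainbow_walk E c S u w (insert (c {u, x}) (insert (c {v, w}) K))"
    by (intro rainbow_walk.step) auto
  then show ?case by (simp add: insert_commute)
qed

lemma rainbow_walk_rev:
  assumes "rainbow_walk E c S u v K" "\<And>x y. E x y \<Longrightarrow> E y x"
  shows "rainbow_walk E c S v u K"
  using assms(1)
proof (induction rule: rainbow_walk.induct)
  case (refl u)
  then show ?case by (rule rainbow_walk.refl)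
next
  case (step u w v K)
  then have "rainbow_walk E c S v u (insert (c {w, u}) K)"
    by (intro rainbow_walk_snoc) (auto simp: assms(2) insert_commute)
  then show ?case by (simp add: insert_commute)
qed

text \<open>Turns the walks that the induction hypothesis gives inside \<open>H\<close> into walks
  of the whole set under the combined colouring.\<close>

lemma rainbow_walk_transfer:
  assumes "rainbow_walk E c S u v K" "S \<subseteq> T"
    and "\<And>x y. x \<in> S \<Longrightarrow> y \<in> S \<Longrightarrow> E x y \<Longrightarrow> c' {x, y} = c {x, y}"
  shows "rainbow_walk E c' T u v K"
  using assms(1)
proof (induction rule: rainbow_walk.induct)
  case (refl u)
  then show ?case using assms(2) by (auto intro: rainbow_walk.refl)
next
  case (step u w v K)
  then have "c' {u, w} = c {u, w}" using rainbow_walk_ends assms(3) by metis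
  then show ?case using rainbow_walk.step[of u T E w c' v K] step assms(2) by auto
qed

lemma rainbow_walk_colors:
  assumes "rainbow_walk E c S u v K"
    and "\<And>x y. x \<in> S \<Longrightarrow> y \<in> S \<Longrightarrow> E x y \<Longrightarrow> c {x, y} < k"
  shows "K \<subseteq> {..<k}"
  using assms(1)
proof (induction rule: rainbow_walk.induct)
  case (step u w v K)
  then show ?case using rainbow_walk_ends assms(2) by fastforce
qed auto

lemma rainbow_walk1:
  "u \<in> S \<Longrightarrow> v \<in> S \<Longrightarrow> E u v \<Longrightarrow> rainbow_walk E c S u v {c {u, v}}"
  by (auto intro!: rainbow_walk.intros)

lemma rainbow_walk2:
  "u \<in> S \<Longrightarrow> w \<in> S \<Longrightarrow> v \<in> S \<Longrightarrow> E u w \<Longrightarrow> E w v \<Longrightarrow> c {u, w} \<noteq> c {w, v} \<Longrightarrow>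
    rainbow_walk E c S u v {c {u, w}, c {w, v}}"
  by (auto intro!: rainbow_walk.intros)

lemma rainbow_walk3:
  "u \<in> S \<Longrightarrow> w \<in> S \<Longrightarrow> x \<in> S \<Longrightarrow> v \<in> S \<Longrightarrow> E u w \<Longrightarrow> E w x \<Longrightarrow> E x v \<Longrightarrow>
    distinct [c {u, w}, c {w, x}, c {x, v}] \<Longrightarrow>
    rainbow_walk E c S u v {c {u, w}, c {w, x}, c {x, v}}"
  by (auto intro!: rainbow_walk.intros)

section \<open>Colouring a star\<close>

text \<open>The labels become star colours, and the last property supplies the detour for pairs with
  equal labels. The vertex \<open>m\<close> of label 0 later serves as the centre of the opposite
  star.\<close>

lemma star_labelling:
  assumes fin: "finite X" and "X \<noteq> {}" and sym: "\<And>x y. E x y \<Longrightarrow> E y x"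
  obtains m g where "m \<in> X" "g m = (0::nat)" "\<forall>x\<in>X. g x < alpha E X"
    "\<forall>x\<in>X. \<forall>x'\<in>X. x \<noteq> x' \<longrightarrow> \<not> E x x' \<longrightarrow> g x = g x' \<longrightarrow>
       (\<exists>y\<in>X. (E y x \<or> E y x') \<and> g y \<noteq> g x)"
proof -
  obtain M where M: "indep E X M" "card M = alpha E X" using obtain_max_indep fin by metis
  have finM: "finite M" and MX: "M \<subseteq> X" using M(1) fin by (auto simp: indep_def intro: finite_subset)
  have pos: "0 < alpha E X" using assms by (simp add: alpha_pos)
  obtain h where h: "bij_betw h M {0..<card M}" using ex_bij_betw_finite_nat finM by blast
  then have "0 \<in> h ` M" using pos M(2) by (simp add: bij_betw_def)
  then obtain m where m: "m \<in> M" "h m = 0" by auto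
  \<comment> \<open>Label 0 is that of \<open>m\<close>, so all vertices outside \<open>M\<close>
    share the label of \<open>m\<close>.\<close>
  define g where "g x = (if x \<in> M then h x else 0)" for x
  have inj: "inj_on h M" using h by (simp add: bij_betw_def)
  have g0: "x = m \<or> x \<notin> M" if "g x = 0" for x
    using that m inj by (auto simp: g_def inj_on_def split: if_splits)
  show ?thesis
  proof (rule that[of m g])
    show "m \<in> X" using m MX by auto
    show "g m = 0" using m by (simp add: g_def)
    show "\<forall>x\<in>X. g x < alpha E X"
      using h pos M(2) bij_betwE by (fastforce simp: g_def)
    show "\<forall>x\<in>X. \<forall>x'\<in>X. x \<noteq> x' \<longrightarrow> \<not> E x x' \<longrightarrow> g x = g x' \<longrightarrow>
       (\<exists>y\<in>X. (E y x \<or> E y x') \<and> g y \<noteq> g x)"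
    proof (intro ballI impI, rule ccontr)
      fix x x' assume x: "x \<in> X" "x' \<in> X" "x \<noteq> x'" "\<not> E x x'" and eq: "g x = g x'"
      assume contra: "\<not> (\<exists>y\<in>X. (E y x \<or> E y x') \<and> g y \<noteq> g x)"
      \<comment> \<open>As \<open>h\<close> is injective on \<open>M\<close>, one of the two
        vertices lies outside \<open>M\<close>.\<close>
      have zero: "g x = 0"
        using eq inj x(3) by (auto simp: g_def inj_on_def split: if_splits)
      have notin: "x \<notin> M - {m}" "x' \<notin> M - {m}" using g0 zero eq by auto
      \<comment> \<open>Members of \<open>M - {m}\<close> have nonzero labels, so adjacency to
        \<open>x\<close> or \<open>x'\<close> would contradict \<open>contra\<close>.\<close>
      have nonadj: "\<not> E y x \<and> \<not> E y x'" if "y \<in> M - {m}" for y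
        using contra that g0[of y] zero MX by auto
      let ?I = "insert x (insert x' (M - {m}))"
      have "indep E X ?I"
        using M(1) x nonadj sym unfolding indep_def pairwise_def by blast
      moreover have "card ?I = Suc (card M)"
        using notin x(3) finM m(1) card_Suc_Diff1[OF finM m(1)] by simp
      ultimately show False using card_le_alpha[OF fin, of E ?I] M(2) by simp
    qed
  qed
qed

text \<open>Keeping labels \<open>g\<close> apart from colours \<open>\<phi>\<close> lets the two
  stars use different palettes. Different labels give the path \<open>x - s - x'\<close>, equal ones
  a detour such as \<open>x - s - y - x'\<close>, whose last edge has the spare colour
  \<open>d\<close>.\<close>

lemma star_rainbow:
  assumes sym: "\<And>x y. E x y \<Longrightarrow> E y x"
    and X: "X \<subseteq> S" "s \<in> S" "\<And>x. x \<in> X \<Longrightarrow> E s x"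
    and lab: "\<forall>x\<in>X. \<forall>x'\<in>X. x \<noteq> x' \<longrightarrow> \<not> E x x' \<longrightarrow> g x = g x' \<longrightarrow>
       (\<exists>y\<in>X. (E y x \<or> E y x') \<and> g y \<noteq> g x)"
    and phi: "inj_on \<phi> (g ` X)" "d \<notin> \<phi> ` g ` X"
    and star: "\<And>x. x \<in> X \<Longrightarrow> c {s, x} = \<phi> (g x)"
    and inner: "\<And>x y. x \<in> X \<Longrightarrow> y \<in> X \<Longrightarrow> E x y \<Longrightarrow> c {x, y} = d"
    and x: "x \<in> X" "x' \<in> X"
  shows "\<exists>K. rainbow_walk E c S x x' K"
proof -
  have star': "c {x, s} = \<phi> (g x)" if "x \<in> X" for x
    using star[OF that] by (simp add: insert_commute)
  have neq: "\<phi> (g x) \<noteq> \<phi> (g y)" if "x \<in> X" "y \<in> X" "g x \<noteq> g y" for x y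
    using phi(1) that by (auto simp: inj_on_def)
  have nd: "\<phi> (g x) \<noteq> d" if "x \<in> X" for x
    using phi(2) that by auto
  have three: "\<exists>K. rainbow_walk E c S u u' K"
    if "u \<in> X" "u' \<in> X" "y \<in> X" "E y u'" "g y \<noteq> g u" for u u' y
  proof -
    have "rainbow_walk E c S u u' {c {u, s}, c {s, y}, c {y, u'}}"
      using that X sym
      by (intro rainbow_walk3) (auto simp: star star' inner neq[THEN not_sym] neq nd)
    then show ?thesis by blast
  qed
  consider "x = x'" | "E x x'" | "x \<noteq> x'" "\<not> E x x'" "g x \<noteq> g x'"
    | "x \<noteq> x'" "\<not> E x x'" "g x = g x'" by blast
  then show ?thesis
  proof cases
    case 1
    then show ?thesis using x X by (auto intro: rainbow_walk.refl)
  next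
    case 2
    then show ?thesis using rainbow_walk1[of x S x' E c] x X by auto
  next
    case 3
    then have "rainbow_walk E c S x x' {c {x, s}, c {s, x'}}"
      using x X sym by (intro rainbow_walk2) (auto simp: star star' neq)
    then show ?thesis by blast
  next
    case 4
    then obtain y where y: "y \<in> X" "g y \<noteq> g x" "E y x \<or> E y x'" using lab x by metis
    \<comment> \<open>In \<open>three\<close> the last edge starts at \<open>y\<close>; if
      \<open>y\<close> is adjacent only to \<open>x\<close>, the walk is built from
      \<open>x'\<close> to \<open>x\<close> and reversed.\<close>
    show ?thesis
    proof (cases "E y x'")
      case True
      then show ?thesis using three y x by blast
    next
      case False
      then obtain K where "rainbow_walk E c S x' x K" using three[of x' x y] y x 4 by auto
      then have "rainbow_walk E c S x x' K" by (rule rainbow_walk_rev) (rule sym)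
      then show ?thesis by blast
    qed
  qed
qed

section \<open>The colouring\<close>

text \<open>An explicit range of colours, rather than a count, makes \<open>k\<close> and everything
  above it new for the colouring of \<open>H\<close>.\<close>

lemma rainbow_coloring_exists:
  fixes V :: "'a set"
  assumes sym: "\<And>x y. E x y \<Longrightarrow> E y x" and irrefl: "\<And>x. \<not> E x x"
  assumes "finite V" "V \<noteq> {}" "cut_connected E V"
  shows "\<exists>c. (\<forall>x\<in>V. \<forall>y\<in>V. E x y \<longrightarrow> c {x, y} < 2 * alpha E V - 1) \<and>
             (\<forall>x\<in>V. \<forall>y\<in>V. \<exists>K. rainbow_walk E c V x y K)"
  using assms(3-5)
proof (induction "card V" arbitrary: V rule: less_induct)
  case less
  note fin = \<open>finite V\<close>
  define far where "far H = {w \<in> V - H. \<forall>h\<in>H. \<not> E h w}" for H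
  define good where "good H \<longleftrightarrow> H \<subseteq> V \<and> H \<noteq> {} \<and> cut_connected E H \<and> far H \<noteq> {}" for H
  show ?case
  proof (cases "\<forall>x\<in>V. \<forall>y\<in>V. x \<noteq> y \<longrightarrow> E x y")
    case True
    have "0 < alpha E V" using less by (simp add: alpha_pos)
    moreover have "\<exists>K. rainbow_walk E (\<lambda>_. 0) V x y K" if "x \<in> V" "y \<in> V" for x y
      using True that rainbow_walk1[of x V y E] rainbow_walk.refl[of x V E]
      by (cases "x = y") blast+
    ultimately show ?thesis by (intro exI[of _ "\<lambda>_. 0"]) auto
  next
    case False
    then obtain x0 y0 where "x0 \<in> V" "y0 \<in> V" "x0 \<noteq> y0" "\<not> E x0 y0" by blast
    \<comment> \<open>\<open>y0\<close> lies in \<open>far {x0}\<close>.\<close>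
    then have "good {x0}" by (auto simp: good_def far_def cut_connected_singleton)
    moreover have "finite {H. good H}"
      by (rule finite_subset[of _ "Pow V"]) (auto simp: good_def fin)
    ultimately obtain H where H: "good H" and Hmax: "\<And>H'. good H' \<Longrightarrow> H \<subseteq> H' \<Longrightarrow> H' = H"
      using finite_has_maximal2[of "{H. good H}" "{x0}"] by auto
    define W where "W = far H"
    define U where "U = V - H - W"
    have HV: "H \<subseteq> V" "H \<noteq> {}" "cut_connected E H" and W0: "W \<noteq> {}"
      using H by (auto simp: good_def W_def)
    have WV: "W \<subseteq> V" "W \<inter> H = {}" and HW: "\<And>h w. h \<in> H \<Longrightarrow> w \<in> W \<Longrightarrow> \<not> E h w \<and> \<not> E w h"
      using sym by (auto simp: W_def far_def)
    have UV: "U \<subseteq> V" "U \<inter> H = {}" "U \<inter> W = {}" and V: "V = H \<union> U \<union> W"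
      using HV WV by (auto simp: U_def)
    have finX: "finite H" "finite U" "finite W" using HV(1) UV(1) WV(1) fin by (auto intro: finite_subset)
    have Unbr: "\<exists>h\<in>H. E h u" if "u \<in> U" for u
      using that unfolding U_def W_def far_def by auto
    \<comment> \<open>Otherwise \<open>w\<close> stays far from \<open>insert u H\<close>, a larger
      \<open>good\<close> set.\<close>
    have UW: "E u w" if u: "u \<in> U" and w: "w \<in> W" for u w
    proof (rule ccontr)
      assume "\<not> E u w"
      then have "w \<in> far (insert u H)"
        using w u UV unfolding W_def far_def by auto
      moreover have "cut_connected E (insert u H)"
        using Unbr[OF u] cut_connected_insert[OF HV(3)] sym by blast
      ultimately have "good (insert u H)" using u UV HV by (auto simp: good_def)
      then have "insert u H = H" using Hmax by blast
      then show False using u UV by blast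
    qed
    \<comment> \<open>If \<open>U\<close> were empty, no edge would leave \<open>H\<close>.\<close>
    have U0: "U \<noteq> {}"
    proof
      assume "U = {}"
      then have "V - H = W" using V WV by auto
      moreover have "H \<noteq> V" using W0 WV by auto
      then obtain x y where "x \<in> H" "y \<in> V - H" "E x y"
        using \<open>cut_connected E V\<close> HV unfolding cut_connected_def by metis
      ultimately show False using HW by blast
    qed
    define N where "N = 2 * alpha E V - 1"
    define k where "k = 2 * alpha E H - 1"
    have apos: "0 < alpha E H" "0 < alpha E W" using alpha_pos[of H E] alpha_pos[of W E] finX HV W0 by auto
    have aadd: "alpha E H + alpha E W \<le> alpha E V"
      using alpha_add[OF fin HV(1) WV(1)] HW WV by blast
    have aU: "alpha E U \<le> alpha E V" using alpha_mono[OF fin UV(1)] .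
    \<comment> \<open>Room for the palettes: below \<open>k\<close> inside \<open>H\<close>,
      \<open>k\<close> between \<open>U\<close> and \<open>H\<close>, \<open>k + 1\<close> to
      \<open>k + alpha E W\<close> for the star at \<open>u0\<close>. As \<alpha>(V) \<ge> 2, there
      is also room for \<open>alpha E U\<close> star colours and one more inside
      \<open>U\<close>.\<close>
    have kN: "k < N" "k + alpha E W < N" "alpha E U < N"
      using apos aadd aU by (auto simp: N_def k_def)
    have "card H < card V" using HV WV W0 fin by (intro psubset_card_mono) auto
    from less(1)[OF this finX(1) HV(2,3)] obtain cH where
      cH: "\<And>x y. x \<in> H \<Longrightarrow> y \<in> H \<Longrightarrow> E x y \<Longrightarrow> cH {x, y} < k"
      and cHw: "\<And>x y. x \<in> H \<Longrightarrow> y \<in> H \<Longrightarrow> \<exists>K. rainbow_walk E cH H x y K"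
      unfolding k_def by metis
    obtain u0 gU where u0: "u0 \<in> U" "gU u0 = 0" and gU': "\<forall>x\<in>U. gU x < alpha E U"
      and labU: "\<forall>x\<in>U. \<forall>x'\<in>U. x \<noteq> x' \<longrightarrow> \<not> E x x' \<longrightarrow> gU x = gU x' \<longrightarrow>
       (\<exists>y\<in>U. (E y x \<or> E y x') \<and> gU y \<noteq> gU x)"
      by (rule star_labelling[of U E, OF finX(2) U0]) (erule sym, rule that)
    obtain v0 gW where v0: "v0 \<in> W" "gW v0 = 0" and gW': "\<forall>x\<in>W. gW x < alpha E W"
      and labW: "\<forall>x\<in>W. \<forall>x'\<in>W. x \<noteq> x' \<longrightarrow> \<not> E x x' \<longrightarrow> gW x = gW x' \<longrightarrow>
       (\<exists>y\<in>W. (E y x \<or> E y x') \<and> gW y \<noteq> gW x)"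
      by (rule star_labelling[of W E, OF finX(3) W0]) (erule sym, rule that)
    note gU = gU'[rule_format] and gW = gW'[rule_format]
    \<comment> \<open>The two stars share the edge between \<open>u0\<close> and \<open>v0\<close>, whose colour is \<open>k + 1\<close> in the star at \<open>u0\<close>.\<close>
    define \<phi> where "\<phi> = transpose (0::nat) (k + 1)"
    \<comment> \<open>\<alpha>(W) \<ge> 1 gives \<open>k + 1 < N\<close>, so \<open>\<phi>\<close>
      permutes the colours below \<open>N\<close>.\<close>
    have phiN: "\<phi> i < N" if "i < N" for i
      using that kN apos by (auto simp: \<phi>_def transpose_def)
    have phi_inj: "inj \<phi>" by (simp add: \<phi>_def)
    \<comment> \<open>The order of the branches matters: the edge \<open>u0 v0\<close> falls to the
      star at \<open>u0\<close>. Colour \<open>k\<close> is reused inside \<open>W\<close>, since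
      the walks from \<open>W\<close> to \<open>H\<close> avoid those edges. Edges between
      \<open>U\<close> and \<open>W\<close> in neither star only serve as walks of length one, so 0
      is harmless.\<close>
    define c where "c e =
      (if e \<subseteq> H then cH e
       else if e \<inter> H \<noteq> {} then k
       else if e \<subseteq> U then \<phi> (alpha E U)
       else if e \<subseteq> W then k
       else if u0 \<in> e then k + 1 + gW (the_elem (e - {u0}))
       else if v0 \<in> e then \<phi> (gU (the_elem (e - {v0})))
       else 0)" for e
    have c_HH: "c {x, y} = cH {x, y}" if "x \<in> H" "y \<in> H" for x y
      using that by (simp add: c_def)
    have c_UH: "c {x, y} = k" if "x \<in> U" "y \<in> H" for x y
      using that UV by (auto simp: c_def)
    have c_UU: "c {x, y} = \<phi> (alpha E U)" if "x \<in> U" "y \<in> U" for x y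
      using that UV by (auto simp: c_def)
    have c_WW: "c {x, y} = k" if "x \<in> W" "y \<in> W" for x y
      using that UV WV by (auto simp: c_def)
    have c_uW: "c {u0, y} = k + 1 + gW y" if "y \<in> W" for y
    proof -
      have "{u0, y} - {u0} = {y}" using that u0 UV by auto
      then show ?thesis using that u0 UV WV by (auto simp: c_def)
    qed
    have c_vU: "c {v0, y} = \<phi> (gU y)" if "y \<in> U" for y
    proof (cases "y = u0")
      \<comment> \<open>The two stars agree here:
        \<open>k + 1 + gW v0 = k + 1 = \<phi> 0 = \<phi> (gU u0)\<close>.\<close>
      case True
      then show ?thesis using c_uW[OF v0(1)] v0 u0 by (simp add: insert_commute \<phi>_def)
    next
      case False
      have "{v0, y} - {v0} = {y}" using that v0 UV by auto
      then show ?thesis using that False v0 u0 UV WV by (auto simp: c_def)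
    qed
    have c_UW: "c {x, y} < N" if "x \<in> U" "y \<in> W" for x y
    proof -
      consider "x = u0" | "y = v0" | "x \<noteq> u0" "y \<noteq> v0" by blast
      then show ?thesis
      proof cases
        case 1
        then show ?thesis using c_uW[OF that(2)] gW[OF that(2)] kN by simp
      next
        case 2
        then show ?thesis using c_vU[OF that(1)] phiN[of "gU x"] gU[OF that(1)] kN
          by (simp add: insert_commute)
      next
        case 3
        then have "u0 \<notin> {x, y}" "v0 \<notin> {x, y}" using that u0 v0 UV by auto
        then show ?thesis using that UV WV kN by (auto simp: c_def)
      qed
    qed
    have bound: "c {x, y} < N" if "x \<in> V" "y \<in> V" "E x y" for x y
    proof -
      have oneway: "c {x, y} < N"
        if "x \<in> H \<and> y \<in> H \<or> x \<in> U \<and> y \<in> H \<union> U \<union> W \<or> x \<in> W \<and> y \<in> W" "E x y" for x y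
        using that c_HH cH c_UH c_UU c_UW c_WW kN phiN by fastforce
      \<comment> \<open>No edge joins \<open>H\<close> and \<open>W\<close>, so these are all cases
        up to exchanging the ends.\<close>
      have "x \<in> H \<and> y \<in> H \<or> x \<in> U \<and> y \<in> H \<union> U \<union> W \<or> x \<in> W \<and> y \<in> W \<or>
            y \<in> U \<and> x \<in> H \<union> U \<union> W"
        using that HW V by auto
      then show ?thesis using oneway[of x y] oneway[of y x] that sym by (auto simp: insert_commute)
    qed
    \<comment> \<open>The colour range is recorded so that an edge of colour \<open>k\<close>, and
      then one of a colour above \<open>k\<close>, can be prepended.\<close>
    have H_walk: "\<exists>K \<subseteq> {..<k}. rainbow_walk E c V x y K" if xy: "x \<in> H" "y \<in> H" for x y
    proof -
      obtain K where K: "rainbow_walk E cH H x y K" using cHw xy by blast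
      have "rainbow_walk E c V x y K"
        by (rule rainbow_walk_transfer[OF K HV(1)]) (simp add: c_HH)
      then show ?thesis using rainbow_walk_colors[OF K cH] by blast
    qed
    have UH_walk: "\<exists>K \<subseteq> {..k}. rainbow_walk E c V u h K" if u: "u \<in> U" and h: "h \<in> H" for u h
    proof -
      obtain h' where h': "h' \<in> H" "E h' u" using Unbr[OF u] by blast
      obtain K where K: "K \<subseteq> {..<k}" "rainbow_walk E c V h' h K" using H_walk[OF h'(1) h] by blast
      have col: "c {u, h'} = k" using c_UH u h' by blast
      have "rainbow_walk E c V u h (insert (c {u, h'}) K)"
        using u UV sym[OF h'(2)] K col by (intro rainbow_walk.step) auto
      moreover have "insert (c {u, h'}) K \<subseteq> {..k}" using col K(1) by auto
      ultimately show ?thesis by blast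
    qed
    have WH_walk: "\<exists>K. rainbow_walk E c V w h K" if w: "w \<in> W" and h: "h \<in> H" for w h
    proof -
      obtain K where K: "K \<subseteq> {..k}" "rainbow_walk E c V u0 h K" using UH_walk[OF u0(1) h] by blast
      have "c {w, u0} = k + 1 + gW w" using c_uW[OF w] by (simp add: insert_commute)
      then have "rainbow_walk E c V w h (insert (c {w, u0}) K)"
        using w WV sym[OF UW[OF u0(1) w]] K by (intro rainbow_walk.step) auto
      then show ?thesis by blast
    qed
    have UW_walk: "\<exists>K. rainbow_walk E c V u w K" if "u \<in> U" "w \<in> W" for u w
      using rainbow_walk1[of u V w E c] UW that UV WV by blast
    \<comment> \<open>These walks are not continued, so their colours may repeat those used
      elsewhere.\<close>
    have UU_walk: "\<exists>K. rainbow_walk E c V u u' K" if u: "u \<in> U" "u' \<in> U" for u u'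
    proof (rule star_rainbow[of E U V v0 gU \<phi> "\<phi> (alpha E U)"])
      show "E y x" if "E x y" for x y using that by (rule sym)
      show "E v0 x" if "x \<in> U" for x using UW[OF that v0(1)] by (rule sym)
      show "v0 \<in> V" using v0 WV by blast
      show "inj_on \<phi> (gU ` U)" using phi_inj by (rule inj_on_subset) simp
      show "\<phi> (alpha E U) \<notin> \<phi> ` gU ` U"
        using gU by (force simp: inj_eq[OF phi_inj])
      show "c {x, y} = \<phi> (alpha E U)" if "x \<in> U" "y \<in> U" for x y using that by (rule c_UU)
    qed (fact UV(1) labU c_vU u)+
    have WW_walk: "\<exists>K. rainbow_walk E c V w w' K" if w: "w \<in> W" "w' \<in> W" for w w'
    proof (rule star_rainbow[of E W V u0 gW "\<lambda>i. k + 1 + i" k])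
      show "E y x" if "E x y" for x y using that by (rule sym)
      show "u0 \<in> V" using u0 UV by blast
      show "inj_on (\<lambda>i. k + 1 + i) (gW ` W)" by (simp add: inj_on_def)
      show "k \<notin> (\<lambda>i. k + 1 + i) ` gW ` W" by auto
      show "E u0 x" if "x \<in> W" for x using UW[OF u0(1) that] .
      show "c {x, y} = k" if "x \<in> W" "y \<in> W" for x y using that by (rule c_WW)
    qed (fact WV(1) labW c_uW w)+
    have rev: "\<exists>K. rainbow_walk E c V y x K" if walk: "\<exists>K. rainbow_walk E c V x y K" for x y
    proof -
      obtain K where "rainbow_walk E c V x y K" using walk by blast
      then have "rainbow_walk E c V y x K" by (rule rainbow_walk_rev) (rule sym)
      then show ?thesis by blast
    qed
    have "\<exists>K. rainbow_walk E c V x y K" if "x \<in> V" "y \<in> V" for x y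
    proof -
      have H: "\<exists>K. rainbow_walk E c V x h K" if "x \<in> H \<union> U \<union> W" "h \<in> H" for x h
        using that(1)
      proof (elim UnE)
        assume "x \<in> H"
        then show ?thesis using H_walk[OF _ that(2)] by blast
      next
        assume "x \<in> U"
        then show ?thesis using UH_walk[OF _ that(2)] by blast
      next
        assume "x \<in> W"
        then show ?thesis using WH_walk[OF _ that(2)] by blast
      qed
      have U: "\<exists>K. rainbow_walk E c V u y K" if "y \<in> U \<union> W" "u \<in> U" for y u
        using that(1) UU_walk[OF that(2)] UW_walk[OF that(2)] by (elim UnE)
      have "x \<in> H \<union> U \<union> W" "y \<in> H \<union> U \<union> W" using that by (simp_all add: V)
      then consider "y \<in> H" "x \<in> H \<union> U \<union> W" | "x \<in> H" "y \<in> H \<union> U \<union> W"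
        | "x \<in> U" "y \<in> U \<union> W" | "y \<in> U" "x \<in> U \<union> W" | "x \<in> W" "y \<in> W"
        by (elim UnE) auto
      then show ?thesis
      proof cases
        case 1
        then show ?thesis using H by simp
      next
        case 2
        then show ?thesis using H rev by simp
      next
        case 3
        then show ?thesis using U by simp
      next
        case 4
        then show ?thesis using U rev by simp
      next
        case 5
        then show ?thesis using WW_walk by simp
      qed
    qed
    then show ?thesis using bound unfolding N_def by blast
  qed
qed

section \<open>Transfer to digraphs\<close>

text \<open>The colour set stays in the conclusion so that the induction step sees that the colour
  of the new arc is fresh.\<close>

lemma (in wf_digraph) rainbow_walk_imp_awalk:
  assumes "rainbow_walk (dominates G) c (verts G) u v K"
  shows "\<exists>p. awalk u p v \<and> rainbow G c p \<and> (\<lambda>e. c (edge_of G e)) ` set p = K"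
  using assms
proof (induction rule: rainbow_walk.induct)
  case (refl u)
  then show ?case by (intro exI[of _ "[]"]) (auto simp: awalk_Nil_iff rainbow_def)
next
  case (step u w v K)
  then obtain p where p: "awalk w p v" "rainbow G c p" "(\<lambda>e. c (edge_of G e)) ` set p = K"
    by blast
  obtain e where e: "e \<in> arcs G" "tail G e = u" "head G e = w" using step by blast
  then have ce: "edge_of G e = {u, w}" by (simp add: edge_of_def)
  have "awalk u (e # p) v" using p e by (simp add: awalk_Cons_iff)
  moreover have "rainbow G c (e # p)" using p step ce by (auto simp: rainbow_def)
  ultimately show ?case using p ce by (intro exI[of _ "e # p"]) auto
qed

text \<open>Cutting cycles out of a walk only drops arcs, and the arcs of a path are distinct, so
  their colours remain distinct.\<close>

lemma (in wf_digraph) rainbow_awalk_imp_apath: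
  assumes "awalk u p v" "rainbow G c p"
  shows "\<exists>q. apath u q v \<and> rainbow G c q"
proof (intro exI conjI)
  show ap: "apath u (awalk_to_apath p) v" using assms(1) by (rule apath_awalk_to_apath)
  then have "distinct (awalk_to_apath p)"
    using distinct_verts_imp_distinct unfolding apath_def by blast
  moreover have "set (awalk_to_apath p) \<subseteq> set p" using assms(1) by (rule awalk_to_apath_subset)
  ultimately show "rainbow G c (awalk_to_apath p)"
    using assms(2) unfolding rainbow_def distinct_map by (blast intro: inj_on_subset)
qed

text \<open>A walk from inside \<open>A\<close> to outside must leave \<open>A\<close> along some
  arc.\<close>

lemma (in sym_digraph) connected_imp_cut_connected:
  assumes "connected G"
  shows "cut_connected (dominates G) (verts G)"
  unfolding cut_connected_def
proof (intro allI impI)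
  fix A assume A: "A \<subseteq> verts G" "A \<noteq> {}" "A \<noteq> verts G"
  then obtain a b where ab: "a \<in> A" "b \<in> verts G - A" by auto
  then have "a \<rightarrow>\<^sup>* b"
    using symmetric_connected_imp_strongly_connected[OF sym_arcs assms] A by blast
  then show "\<exists>x\<in>A. \<exists>y\<in>verts G - A. x \<rightarrow>\<^bsub>G\<^esub> y"
    using ab
  proof (induction rule: converse_reachable_induct)
    case (step x y)
    then show ?case using adj_in_verts by (cases "y \<in> A") blast+
  qed auto
qed

text \<open>The strict form of the bound avoids truncated subtraction.\<close>

lemma (in graph) obtain_rainbow_coloring:
  assumes "connected G"
  obtains c where "rainbow_connected G c" "card (c ` uedges G) < 2 * independence_number G"
proof -
  let ?E = "dominates G"
  \<comment> \<open>Connectedness in the library excludes the empty graph.\<close>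
  have ne: "verts G \<noteq> {}"
    using symmetric_connected_imp_strongly_connected[OF sym_arcs assms]
    by (simp add: strongly_connected_def)
  have alpha: "independence_number G = alpha ?E (verts G)"
    by (simp add: independence_number_def alpha_def independent_set_def indep_def)
  obtain c where c: "\<And>x y. x \<in> verts G \<Longrightarrow> y \<in> verts G \<Longrightarrow> ?E x y \<Longrightarrow>
      c {x, y} < 2 * alpha ?E (verts G) - 1"
    and w: "\<And>x y. x \<in> verts G \<Longrightarrow> y \<in> verts G \<Longrightarrow> \<exists>K. rainbow_walk ?E c (verts G) x y K"
    using rainbow_coloring_exists[of ?E "verts G", OF graph_symmetric _ finite_verts ne
        connected_imp_cut_connected[OF assms]] adj_not_same
    by metis
  have "rainbow_connected G c"
    unfolding rainbow_connected_def
    using w rainbow_walk_imp_awalk rainbow_awalk_imp_apath by metis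
  moreover have "c ` uedges G \<subseteq> {..<2 * alpha ?E (verts G) - 1}"
    using c by (force simp: uedges_def edge_of_def arcs_ends_conv)
  then have "card (c ` uedges G) \<le> 2 * alpha ?E (verts G) - 1"
    using card_mono[of "{..<2 * alpha ?E (verts G) - 1}"] by fastforce
  ultimately show ?thesis using that alpha_pos[OF finite_verts ne, of ?E] alpha by simp
qed

section \<open>The upper bound and its sharpness\<close>

lemma rainbow_connection_number_bound:
  assumes "graph G" "connected G"
  shows "int (rainbow_connection_number G) \<le> 2 * int (independence_number G) - 1"
proof -
  obtain c where c: "rainbow_connected G c" "card (c ` uedges G) < 2 * independence_number G"
    using graph.obtain_rainbow_coloring assms by blast
  then have "rainbow_connection_number G \<le> card (c ` uedges G)"
    unfolding rainbow_connection_number_def by (intro Least_le) auto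
  with c(2) show ?thesis by linarith
qed

text \<open>Some rainbow colouring exists, so the least number is attained, and colouring a nonempty
  edge set takes a colour.\<close>

lemma rainbow_connection_number_pos:
  assumes "graph G" "connected G" "arcs G \<noteq> {}"
  shows "0 < rainbow_connection_number G"
proof -
  interpret graph G by fact
  have "\<exists>c. rainbow_connected G c \<and> card (c ` uedges G) = rainbow_connection_number G"
    unfolding rainbow_connection_number_def
    by (rule LeastI_ex) (use obtain_rainbow_coloring assms(2) in blast)
  then obtain c where "rainbow_connected G c" "card (c ` uedges G) = rainbow_connection_number G"
    by blast
  moreover have "0 < card (c ` uedges G)" using assms(3) by (simp add: card_gt_0_iff uedges_def)
  ultimately show ?thesis by simp
qed

text \<open>For a single edge, \<alpha> \<le> 1 and at least one colour squeeze both sides of the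
  bound to 1.\<close>

lemma sharp_example:
  "\<exists>G :: (nat, nat \<times> nat) pre_digraph. graph G \<and> connected G \<and>
     int (rainbow_connection_number G) = 2 * int (independence_number G) - 1"
proof -
  define G :: "(nat, nat \<times> nat) pre_digraph" where
    "G = \<lparr>verts = {0, 1}, arcs = {(0, 1), (1, 0)}, tail = fst, head = snd\<rparr>"
  have G: "graph G"
    by unfold_locales (auto simp: G_def arc_to_ends_def symmetric_conv)
  interpret graph G by fact
  have dom: "0 \<rightarrow>\<^bsub>G\<^esub> 1" "1 \<rightarrow>\<^bsub>G\<^esub> 0" by (auto simp: G_def arcs_ends_conv)
  \<comment> \<open>Connectedness is defined through the symmetric closure, hence the passage to
    \<open>mk_symmetric G\<close>.\<close>
  have "u \<rightarrow>\<^sup>*\<^bsub>with_proj (mk_symmetric G)\<^esub> v" if "u \<in> verts G" "v \<in> verts G" for u v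
  proof -
    have "u \<in> {0, 1}" "v \<in> {0, 1}" using that by (auto simp: G_def)
    then have "u \<rightarrow>\<^sup>*\<^bsub>G\<^esub> v" using dom that by auto
    then show ?thesis by (rule reachable_mk_symmetricI)
  qed
  then have conn: "connected G"
    unfolding connected_def by (intro strongly_connectedI) (auto simp: mk_symmetric_def G_def)
  have "card S \<le> 1" if "independent_set G S" for S
  proof -
    have "S \<subseteq> {0, 1}" "\<not> (0 \<in> S \<and> 1 \<in> S)"
      using that dom by (auto simp: independent_set_def pairwise_def G_def)
    then have "S \<subseteq> {0} \<or> S \<subseteq> {1}" by auto
    then show ?thesis using card_mono[of "{_::nat}" S] by auto
  qed
  moreover have "finite {S. independent_set G S}"
    by (rule finite_subset[of _ "Pow (verts G)"]) (auto simp: independent_set_def)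
  moreover have "independent_set G {}" by (simp add: independent_set_def)
  ultimately have "independence_number G \<le> 1"
    unfolding independence_number_def by (intro Max.boundedI) auto
  moreover have "arcs G \<noteq> {}" by (simp add: G_def)
  then have "0 < rainbow_connection_number G" by (rule rainbow_connection_number_pos[OF G conn])
  ultimately have "int (rainbow_connection_number G) = 2 * int (independence_number G) - 1"
    using rainbow_connection_number_bound[OF G conn] by linarith
  then show ?thesis using G conn by blast
qed

theorem theorem1:
  shows "(\<forall>G :: ('a, 'b) pre_digraph. graph G \<and> Digraph_Component.connected G \<longrightarrow>
            int (rainbow_connection_number G) \<le> 2 * int (independence_number G) - 1)
       \<and> (\<exists>G :: (nat, nat \<times> nat) pre_digraph. graph G \<and> Digraph_Component.connected G \<and>
            int (rainbow_connection_number G) = 2 * int (independence_number G) - 1)"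
  using rainbow_connection_number_bound sharp_example by blast

end
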